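(* Let $z_1,\dots,z_m$ be real-valued test statistics, $z_i$ having marginal density $f^{(i)}$, for null hypotheses $H_1,\dots,H_m$ with fixed truth statuses, and let $\lambda>0$. If $\delta$ is a separable decision rule, i.e. $\delta_i(z_1,\dots,z_m)=g(z_i)$ for $i=1,\dots,m$ for some univariate (measurable) function $g:\mathbb{R}\to\{\text{reject},\text{accept}\}$, then $$\mathbb{E}\,L_\lambda(H,\delta)\ \ge\ \mathbb{E}\,L_\lambda(H,\mathfrak d^* ),$$ where $$\mathfrak d^*_i(z_1,\dots,z_m)=\begin{cases}\text{reject} & \text{if } \mathrm{lfdr}(z_i)\le \frac{1}{1+\lambda},\\ \text{accept} & \text{otherwise.}\end{cases}$$
   Context: The frequentist local false discovery rate is $$\mathrm{lfdr}(t)=\frac{\sum_{i:\,H_i\text{ is true}} f^{(i)}(t)}{\sum_{i=1}^m f^{(i)}(t)}$$ (arbitrary where the denominator vanishes). A decision rule is a map $\delta(z_1,\dots,z_m)\in\{\text{reject},\text{accept}\}^m$. The weighted classification loss is $$L_\lambda(H,\delta)=\lambda\cdot\#\{i:\ \delta_i=\text{reject},\ H_i\text{ true}\}+\#\{i:\ \delta_i=\text{accept},\ H_i\text{ false}\}.$$ No independence of the statistics is assumed. *)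

theory Defs
  imports "HOL-Probability.Probability"
begin

text \<open>
  The \<open>m\<close> hypotheses are indexed by a finite type \<^typ>\<open>'m::finite\<close>, so that
  \<open>m = CARD('m)\<close> is arbitrary. The fixed truth statuses are a predicate
  \<open>H :: 'm \<Rightarrow> bool\<close>, where \<open>H i\<close> means that the \<open>i\<close>-th null hypothesis is true.
\<close>

datatype decision = Reject | Accept

type_synonym 'm decision_rule = "('m \<Rightarrow> real) \<Rightarrow> 'm \<Rightarrow> decision"

definition weighted_loss :: "real \<Rightarrow> ('m::finite \<Rightarrow> bool) \<Rightarrow> ('m \<Rightarrow> decision) \<Rightarrow> real" where
  "weighted_loss lam H d =
     lam * real (card {i. d i = Reject \<and> H i}) + real (card {i. d i = Accept \<and> \<not> H i})"

text \<open>
  The local false discovery rate is arbitrary where the denominator vanishes. It is therefore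
  specified rather than defined: any real function with the prescribed values elsewhere qualifies,
  and no regularity (not even measurability) is imposed on the remaining values.
\<close>

definition is_lfdr :: "('m::finite \<Rightarrow> bool) \<Rightarrow> ('m \<Rightarrow> real \<Rightarrow> real) \<Rightarrow> (real \<Rightarrow> real) \<Rightarrow> bool" where
  "is_lfdr H f l \<longleftrightarrow>
     (\<forall>t. (\<Sum>i\<in>UNIV. f i t) \<noteq> 0 \<longrightarrow> l t = (\<Sum>i\<in>{i. H i}. f i t) / (\<Sum>i\<in>UNIV. f i t))"

definition separable_rule :: "'m decision_rule \<Rightarrow> bool" where
  "separable_rule \<delta> \<longleftrightarrow>
     (\<exists>g \<in> borel \<rightarrow>\<^sub>M count_space UNIV. \<forall>x i. \<delta> x i = g (x i))"

definition lfdr_rule :: "real \<Rightarrow> (real \<Rightarrow> real) \<Rightarrow> 'm decision_rule" where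
  "lfdr_rule lam l x i = (if l (x i) \<le> 1 / (1 + lam) then Reject else Accept)"

text \<open>
  The loss is nonnegative, so its expectation is taken as a nonnegative integral. For a measurable
  loss this is the usual expectation (see below). The nonnegative integral is also unaffected by
  changes of the integrand on a null set, measurable or not, whereas the Bochner integral would
  silently be \<open>0\<close> if the arbitrary values of the local false discovery rate made the loss
  non-measurable.
\<close>

definition expected_loss ::
  "'a measure \<Rightarrow> ('m::finite \<Rightarrow> 'a \<Rightarrow> real) \<Rightarrow> real \<Rightarrow> ('m \<Rightarrow> bool) \<Rightarrow> 'm decision_rule \<Rightarrow> ennreal" where
  "expected_loss M z lam H \<delta> =
     (\<integral>\<^sup>+\<omega>. ennreal (weighted_loss lam H (\<delta> (\<lambda>i. z i \<omega>))) \<partial>M)"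

lemma expected_loss_eq_expectation:
  fixes z :: "'m::finite \<Rightarrow> 'a \<Rightarrow> real"
  assumes "prob_space M" "0 \<le> lam"
    and meas: "(\<lambda>\<omega>. weighted_loss lam H (\<delta> (\<lambda>i. z i \<omega>))) \<in> borel_measurable M"
  shows "expected_loss M z lam H \<delta> =
    ennreal (prob_space.expectation M (\<lambda>\<omega>. weighted_loss lam H (\<delta> (\<lambda>i. z i \<omega>))))"
proof -
  interpret prob_space M by fact
  have nonneg: "0 \<le> weighted_loss lam H d" for d
    using \<open>0 \<le> lam\<close> by (simp add: weighted_loss_def)
  have "weighted_loss lam H d \<le> lam * real CARD('m) + real CARD('m)" for d
    unfolding weighted_loss_def
    by (intro add_mono mult_left_mono \<open>0 \<le> lam\<close> of_nat_mono card_mono) auto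
  then have "integrable M (\<lambda>\<omega>. weighted_loss lam H (\<delta> (\<lambda>i. z i \<omega>)))"
    using meas nonneg
    by (intro integrable_const_bound[where B = "lam * real CARD('m) + real CARD('m)"]) auto
  then show ?thesis
    unfolding expected_loss_def by (intro nn_integral_eq_integral) (use nonneg in auto)
qed

end

theory Submission
  imports Defs
begin

text \<open>
  The loss is additive over the coordinates. For a rule that applies one measurable function \<open>g\<close>
  to every statistic, linearity of the expectation reduces the risk to a sum of one-dimensional
  integrals against the marginal densities; the joint law of the statistics never enters. Moving
  the sum back inside gives
  \[ \int \sum_i f^{(i)}(t) \, c_i(g(t)) \, dt, \]
  where \<open>c_i\<close> is the cost that a decision incurs at coordinate \<open>i\<close>. This is
  the integral of a quantity that depends on \<open>g\<close> only through the single value \<open>g t\<close>, so it is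
  minimized by minimizing the integrand separately at each \<open>t\<close>. Rejecting costs \<open>\<lambda>\<close> times
  the sum of the null densities at \<open>t\<close>, accepting costs the sum of the non-null ones, and comparing
  the two is the same as comparing the local false discovery rate with \<open>1 / (1 + \<lambda>)\<close>
  (\<open>lfdr_threshold_minimizes\<close>).

  The risk formula needs a measurable \<open>g\<close>, whereas the local false discovery rate is arbitrary
  on the zero set of the sum of the densities. Every statistic avoids that set almost
  surely, so there the rate may be replaced by a measurable quotient without changing the risk
  (\<open>expected_loss_lfdr_rule_unique\<close>).
\<close>

definition decision_cost :: "real \<Rightarrow> bool \<Rightarrow> decision \<Rightarrow> real" where
  "decision_cost lam h d =
     (case d of Reject \<Rightarrow> if h then lam else 0 | Accept \<Rightarrow> if h then 0 else 1)"

lemma decision_cost_nonneg: "0 \<le> lam \<Longrightarrow> 0 \<le> decision_cost lam h d"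
  by (simp add: decision_cost_def split: decision.split)

lemma weighted_loss_eq_sum_decision_cost:
  "weighted_loss lam H d = (\<Sum>i\<in>UNIV. decision_cost lam (H i) (d i))"
proof -
  have "decision_cost lam (H i) (d i) =
      lam * of_bool (d i = Reject \<and> H i) + of_bool (d i = Accept \<and> \<not> H i)" for i
    by (cases "d i") (simp_all add: decision_cost_def)
  then show ?thesis
    by (simp add: weighted_loss_def sum.distrib sum_distrib_left[symmetric] Int_def)
qed

lemma sum_density_decision_cost:
  fixes w :: "'m::finite \<Rightarrow> real"
  shows "(\<Sum>i\<in>UNIV. w i * decision_cost lam (H i) d) =
    (case d of Reject \<Rightarrow> lam * (\<Sum>i\<in>{i. H i}. w i)
             | Accept \<Rightarrow> (\<Sum>i\<in>UNIV. w i) - (\<Sum>i\<in>{i. H i}. w i))"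
proof (cases d)
  case Reject
  have "(\<Sum>i\<in>UNIV. w i * decision_cost lam (H i) Reject) =
      (\<Sum>i\<in>UNIV. if i \<in> {i. H i} then lam * w i else 0)"
    by (intro sum.cong) (auto simp: decision_cost_def)
  also have "\<dots> = lam * (\<Sum>i\<in>{i. H i}. w i)"
    by (simp add: sum.If_cases sum_distrib_left)
  finally show ?thesis by (simp add: Reject)
next
  case Accept
  have "(\<Sum>i\<in>UNIV. w i * decision_cost lam (H i) Accept) =
      (\<Sum>i\<in>UNIV. w i - (if i \<in> {i. H i} then w i else 0))"
    by (intro sum.cong) (auto simp: decision_cost_def)
  also have "\<dots> = (\<Sum>i\<in>UNIV. w i) - (\<Sum>i\<in>{i. H i}. w i)"
    by (simp add: sum_subtractf sum.If_cases)
  finally show ?thesis by (simp add: Accept)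
qed

text \<open>
  With \<open>N\<close> the total null weight and \<open>S > 0\<close> the total weight, \<open>N / S \<le> 1 / (1 + \<lambda>)\<close> is
  equivalent to \<open>\<lambda> N \<le> S - N\<close>, that is, to rejection being at most as costly as acceptance.
  If \<open>S = 0\<close> all weights vanish and both decisions are free.
\<close>

lemma lfdr_threshold_minimizes:
  fixes w :: "'m::finite \<Rightarrow> real"
  assumes w: "\<And>i. 0 \<le> w i" and lam: "0 \<le> lam"
  shows "(\<Sum>i\<in>UNIV. w i * decision_cost lam (H i)
            (if (\<Sum>i\<in>{i. H i}. w i) / (\<Sum>i\<in>UNIV. w i) \<le> 1 / (1 + lam) then Reject else Accept))
       \<le> (\<Sum>i\<in>UNIV. w i * decision_cost lam (H i) d)"
proof (cases "(\<Sum>i\<in>UNIV. w i) = 0")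
  case True
  then have "w i = 0" for i
    using w by (simp add: sum_nonneg_eq_0_iff)
  then show ?thesis by simp
next
  case False
  define N S where "N = (\<Sum>i\<in>{i. H i}. w i)" and "S = (\<Sum>i\<in>UNIV. w i)"
  have "0 < S"
    using False w by (simp add: S_def sum_nonneg less_le)
  then have "N / S \<le> 1 / (1 + lam) \<longleftrightarrow> lam * N \<le> S - N"
    using lam by (simp add: field_simps)
  then show ?thesis
    unfolding sum_density_decision_cost N_def[symmetric] S_def[symmetric]
    by (auto split: decision.split)
qed

lemma borel_measurable_density:
  assumes "\<And>t. 0 \<le> f t" and "distributed M lborel X (\<lambda>t. ennreal (f t))"
  shows "f \<in> borel_measurable borel"
  using distributed_real_measurable[OF _ assms(2)] assms(1) by simp

text \<open>
  Only the marginal laws occur on the right-hand side because the loss is additive: dependence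
  between the statistics cannot affect the risk of a rule that treats each statistic separately.
\<close>

lemma expected_loss_separable:
  fixes z :: "'m::finite \<Rightarrow> 'a \<Rightarrow> real"
  assumes f: "\<And>i t. 0 \<le> f i t"
    and z: "\<And>i. distributed M lborel (z i) (\<lambda>t. ennreal (f i t))"
    and lam: "0 \<le> lam"
    and g [measurable]: "g \<in> borel \<rightarrow>\<^sub>M count_space UNIV"
  shows "expected_loss M z lam H (\<lambda>x i. g (x i)) =
    (\<integral>\<^sup>+t. ennreal (\<Sum>i\<in>UNIV. f i t * decision_cost lam (H i) (g t)) \<partial>lborel)"
proof -
  have [measurable]: "f i \<in> borel_measurable borel" for i
    using borel_measurable_density[OF f z] .
  have [measurable]: "z i \<in> borel_measurable M" for i
    using distributed_measurable[OF z] by simp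
  have [measurable]: "(\<lambda>t. decision_cost lam (H i) (g t)) \<in> borel_measurable borel" for i
    by (rule measurable_compose[OF g]) simp
  have "expected_loss M z lam H (\<lambda>x i. g (x i)) =
      (\<integral>\<^sup>+\<omega>. (\<Sum>i\<in>UNIV. ennreal (decision_cost lam (H i) (g (z i \<omega>)))) \<partial>M)"
    by (simp add: expected_loss_def weighted_loss_eq_sum_decision_cost
        decision_cost_nonneg[OF lam] sum_ennreal)
  also have "\<dots> = (\<Sum>i\<in>UNIV. \<integral>\<^sup>+\<omega>. ennreal (decision_cost lam (H i) (g (z i \<omega>))) \<partial>M)"
    by (rule nn_integral_sum) measurable
  also have "\<dots> =
      (\<Sum>i\<in>UNIV. \<integral>\<^sup>+t. ennreal (f i t) * ennreal (decision_cost lam (H i) (g t)) \<partial>lborel)"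
    by (intro sum.cong refl distributed_nn_integral[OF z, symmetric]) measurable
  also have "\<dots> =
      (\<integral>\<^sup>+t. (\<Sum>i\<in>UNIV. ennreal (f i t) * ennreal (decision_cost lam (H i) (g t))) \<partial>lborel)"
    by (rule nn_integral_sum[symmetric]) measurable
  also have "\<dots> = (\<integral>\<^sup>+t. ennreal (\<Sum>i\<in>UNIV. f i t * decision_cost lam (H i) (g t)) \<partial>lborel)"
    by (simp add: f decision_cost_nonneg[OF lam] ennreal_mult[symmetric] sum_ennreal)
  finally show ?thesis .
qed

text \<open>
  Two versions of the local false discovery rate can differ only where all densities vanish, and
  each statistic falls there with probability zero, its own density being one of them.
\<close>

lemma expected_loss_lfdr_rule_unique:
  fixes z :: "'m::finite \<Rightarrow> 'a \<Rightarrow> real"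
  assumes f: "\<And>i t. 0 \<le> f i t"
    and z: "\<And>i. distributed M lborel (z i) (\<lambda>t. ennreal (f i t))"
    and l: "is_lfdr H f l" and l': "is_lfdr H f l'"
  shows "expected_loss M z lam H (lfdr_rule lam l) = expected_loss M z lam H (lfdr_rule lam l')"
proof -
  have [measurable]: "f i \<in> borel_measurable borel" for i
    using borel_measurable_density[OF f z] .
  have "AE \<omega> in M. (\<Sum>j\<in>UNIV. f j (z i \<omega>)) \<noteq> 0" for i
  proof -
    have "(\<Sum>j\<in>UNIV. f j t) \<noteq> 0" if "0 < f i t" for t
      using that f by (auto simp: sum_nonneg_eq_0_iff less_le)
    then have "AE t in distr M lborel (z i). (\<Sum>j\<in>UNIV. f j t) \<noteq> 0"
      unfolding distributed_distr_eq_density[OF z[of i]]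
      by (subst AE_density) auto
    then show ?thesis
      by (rule AE_distrD[OF distributed_measurable[OF z]])
  qed
  then have "AE \<omega> in M. \<forall>i. (\<Sum>j\<in>UNIV. f j (z i \<omega>)) \<noteq> 0"
    by (simp add: AE_all_countable)
  then show ?thesis
    unfolding expected_loss_def
  proof (intro nn_integral_cong_AE, elim AE_mp, intro AE_I2 impI)
    fix \<omega>
    assume "\<forall>i. (\<Sum>j\<in>UNIV. f j (z i \<omega>)) \<noteq> 0"
    then have "l (z i \<omega>) = l' (z i \<omega>)" for i
      using l l' by (simp add: is_lfdr_def)
    then show "ennreal (weighted_loss lam H (lfdr_rule lam l (\<lambda>i. z i \<omega>))) =
        ennreal (weighted_loss lam H (lfdr_rule lam l' (\<lambda>i. z i \<omega>)))"
      by (simp add: lfdr_rule_def weighted_loss_def)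
  qed
qed

theorem theorem2p3:
  fixes M :: "'a measure"
    and z :: "'m::finite \<Rightarrow> 'a \<Rightarrow> real"
    and f :: "'m \<Rightarrow> real \<Rightarrow> real"
    and H :: "'m \<Rightarrow> bool"
    and lam :: real
    and lfdr :: "real \<Rightarrow> real"
    and \<delta> :: "'m decision_rule"
  assumes "prob_space M"
    and "\<And>i t. 0 \<le> f i t"
    and "\<And>i. distributed M lborel (z i) (\<lambda>t. ennreal (f i t))"
    and "lam > 0"
    and "is_lfdr H f lfdr"
    and "separable_rule \<delta>"
  shows "expected_loss M z lam H \<delta> \<ge> expected_loss M z lam H (lfdr_rule lam lfdr)"
proof -
  note f = assms(2) and z = assms(3)
  have lam: "0 \<le> lam" using \<open>lam > 0\<close> by simp
  obtain g where g: "g \<in> borel \<rightarrow>\<^sub>M count_space UNIV" and "\<And>x i. \<delta> x i = g (x i)"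
    using \<open>separable_rule \<delta>\<close> by (auto simp: separable_rule_def)
  then have \<delta>: "\<delta> = (\<lambda>x i. g (x i))" by (intro ext)
  have [measurable]: "f i \<in> borel_measurable borel" for i
    using borel_measurable_density[OF f z] .
  \<comment> \<open>Division by zero yields \<open>0\<close>, so this quotient is a Borel version of the rate on the whole line.\<close>
  define l where "l t = (\<Sum>i\<in>{i. H i}. f i t) / (\<Sum>i\<in>UNIV. f i t)" for t
  define r where "r t = (if l t \<le> 1 / (1 + lam) then Reject else Accept)" for t
  have l: "is_lfdr H f l" by (simp add: is_lfdr_def l_def)
  have [measurable]: "l \<in> borel_measurable borel" unfolding l_def by measurable
  have r: "r \<in> borel \<rightarrow>\<^sub>M count_space UNIV" unfolding r_def by measurable
  have "lfdr_rule lam l = (\<lambda>(x :: 'm \<Rightarrow> real) i. r (x i))"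
    by (intro ext) (simp add: lfdr_rule_def r_def)
  then have "expected_loss M z lam H (lfdr_rule lam lfdr) =
      expected_loss M z lam H (\<lambda>x i. r (x i))"
    using expected_loss_lfdr_rule_unique[OF f z \<open>is_lfdr H f lfdr\<close> l, of lam] by simp
  also have "\<dots> = (\<integral>\<^sup>+t. ennreal (\<Sum>i\<in>UNIV. f i t * decision_cost lam (H i) (r t)) \<partial>lborel)"
    by (rule expected_loss_separable[OF f z lam r])
  also have "\<dots> \<le> (\<integral>\<^sup>+t. ennreal (\<Sum>i\<in>UNIV. f i t * decision_cost lam (H i) (g t)) \<partial>lborel)"
    unfolding r_def l_def
    by (intro nn_integral_mono ennreal_leI lfdr_threshold_minimizes f lam)
  also have "\<dots> = expected_loss M z lam H \<delta>"
    unfolding \<delta> by (rule expected_loss_separable[OF f z lam g, symmetric])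
  finally show ?thesis .
qed

end
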